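(* Assume the following conjecture holds: (Conjecture) Whenever $\ell\geq 1$, $y_1,\dots,y_\ell,z$ are real numbers such that $z$ is not in the $\mathbb{Q}$-linear span of $1,y_1,\dots,y_\ell$, and $\varepsilon,\delta>0$, then for every $n_0>0$ there exist integers $n_0<n_1<n_2<\dots<n_M$ and real numbers $w_1,\dots,w_\ell$ such that (1) $\max_{1\le i\le \ell}\|n_m y_i-w_i\|\leq \varepsilon/2$ for all $m=1,\dots,M$, and (2) the Lebesgue measure of $$\Big(\bigcup_{m=1}^M \Big(\tfrac{\mathbb{Z}+z}{k_m}+\big(-\tfrac{\varepsilon}{2K},\tfrac{\varepsilon}{2K}\big)\Big)\Big)\cap[0,1)$$ is at least $1-\delta$, where $K=\prod_{m=1}^M(n_m+1)$ and $k_m=K/(n_m+1)$. Let $(y_i)_{i\ge1}$ and $(z_i)_{i\ge1}$ be sequences of real numbers such that no $z_i$ lies in the $\mathbb{Q}$-linear span of $1$ together with finitely many elements of $\{y_i\}$. Then there is a function $\psi:\mathbb{Z}_{\geq1}\to[0,\infty)$ such that $\sum_{n\ge1}\psi(n)$ diverges, such that for every $y\in\{y_i\}$ almost no real $x$ (in the sense of Lebesgue measure) satisfies $\|nx+y\|<\psi(n)$ for infinitely many integers $n\geq1$, and such that for every $z\in\{z_i\}$ almost every real $x$ satisfies $\|nx+z\|<\psi(n)$ for infinitely many integers $n\geq 1$.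
   Context: For a real number $t$, $\|t\|$ denotes the distance from $t$ to the nearest integer. For a real number $z$ and positive integer $k$, $(\mathbb{Z}+z)/k$ denotes the set $\{(a+z)/k : a\in\mathbb{Z}\}$, and $S+(u,v)$ denotes $\{s+t: s\in S, t\in(u,v)\}$. *)

theory Defs
  imports "HOL-Analysis.Analysis"
begin

definition nearest_int_dist :: "real \<Rightarrow> real" where
  "nearest_int_dist t = \<bar>t - of_int (round t)\<bar>"

global_interpretation rat_real: vector_space "\<lambda>(q::rat) (x::real). of_rat q * x"
  defines rat_span = rat_real.span
  by unfold_locales (simp_all add: algebra_simps of_rat_add of_rat_mult)

definition shifted_lattice :: "real \<Rightarrow> nat \<Rightarrow> real set" where
  "shifted_lattice z k = {(of_int a + z) / of_nat k | a :: int. True}"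

definition interval_thicken :: "real set \<Rightarrow> real \<Rightarrow> real \<Rightarrow> real set" where
  "interval_thicken S u v = {s + t | s t. s \<in> S \<and> t \<in> {u<..<v}}"

text \<open>The division defining \<open>k\<close> is exact, since \<open>n m + 1\<close> is a factor of \<open>K\<close>.\<close>

definition covering_conjecture :: bool where
  "covering_conjecture \<longleftrightarrow>
    (\<forall>(l::nat) (y::nat \<Rightarrow> real) (z::real) (\<epsilon>::real) (\<delta>::real).
      l \<ge> 1 \<longrightarrow> z \<notin> rat_span (insert 1 (y ` {1..l})) \<longrightarrow> \<epsilon> > 0 \<longrightarrow> \<delta> > 0 \<longrightarrow>
      (\<forall>n0::nat. n0 > 0 \<longrightarrow>
        (\<exists>(M::nat) (n::nat \<Rightarrow> nat) (w::nat \<Rightarrow> real).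
          M \<ge> 1 \<and> n 0 = n0 \<and> strict_mono_on {0..M} n \<and>
          (\<forall>m\<in>{1..M}. (MAX i\<in>{1..l}. nearest_int_dist (real (n m) * y i - w i)) \<le> \<epsilon> / 2) \<and>
          (let K = (\<Prod>m=1..M. (n m + 1));
               k = (\<lambda>m. K div (n m + 1))
           in measure lebesgue
                ((\<Union>m\<in>{1..M}. interval_thicken (shifted_lattice z (k m))
                     (- (\<epsilon> / (2 * real K))) (\<epsilon> / (2 * real K))) \<inter> {0..<1})
              \<ge> 1 - \<delta>))))"

end

theory Submission
  imports Defs
begin

text \<open>
  Let \<open>n\<^sub>1 < \<dots> < n\<^sub>M\<close>, \<open>K\<close>, \<open>k\<^sub>m\<close> be as in the conjecture and put weight
  \<open>\<psi>(k\<^sub>m) = \<epsilon> k\<^sub>m / (2K) = \<epsilon> / (2 (n\<^sub>m + 1))\<close>. The conjecture says that almost all of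
  \<open>[0,1)\<close> is covered for the shift \<open>z\<close>. If instead \<open>\<parallel>k\<^sub>m x + y\<^sub>i\<parallel> < \<psi>(k\<^sub>m)\<close>, then multiplying by
  \<open>n\<^sub>m + 1\<close> and using \<open>n\<^sub>m y\<^sub>i \<approx> w\<^sub>i\<close> gives \<open>\<parallel>K x + y\<^sub>i + w\<^sub>i\<parallel> < \<epsilon>\<close>, a condition that does not
  depend on \<open>m\<close> and has measure \<open>O(\<epsilon>)\<close>. Concatenating such blocks with
  \<open>\<epsilon> = \<delta>\<close> decreasing geometrically, visiting each \<open>z\<^sub>i\<close> infinitely often, and applying
  Borel--Cantelli gives both almost-everywhere claims. Divergence of \<open>\<Sum>\<psi>\<close> follows from the
  claim for \<open>z\<^sub>1\<close>, again by Borel--Cantelli.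
\<close>

section \<open>Approximation strips in the unit interval and their measure\<close>

definition strip :: "nat \<Rightarrow> real \<Rightarrow> real \<Rightarrow> real set" where
  "strip n c r = {x \<in> {0..<1}. nearest_int_dist (real n * x + c) < r}"

lemma nearest_int_dist_le: "nearest_int_dist t \<le> \<bar>t - of_int a\<bar>"
  unfolding nearest_int_dist_def by (rule round_diff_minimal)

lemma nearest_int_dist_nonneg: "nearest_int_dist t \<ge> 0"
  by (simp add: nearest_int_dist_def)

lemma nearest_int_dist_less_iff: "nearest_int_dist t < r \<longleftrightarrow> (\<exists>a::int. \<bar>t - of_int a\<bar> < r)"
  using nearest_int_dist_le[of t] unfolding nearest_int_dist_def
  by (meson le_less_trans)

lemma nearest_int_dist_add_int: "nearest_int_dist (t + of_int a) = nearest_int_dist t"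
proof -
  have "t + of_int a + 1/2 = t + 1/2 + of_int a" by simp
  then have "round (t + of_int a) = round t + a" unfolding round_def by (metis floor_add_int)
  then show ?thesis by (simp add: nearest_int_dist_def)
qed

lemma strip_borel: "strip n c r \<in> sets borel"
  unfolding strip_def nearest_int_dist_def round_def by measurable

lemma strip_lmeasurable: "strip n c r \<in> lmeasurable"
proof (rule fmeasurableI2[of "{0..1::real}"])
  show "{0..1::real} \<in> lmeasurable" by simp
  show "strip n c r \<subseteq> {0..1}" by (auto simp: strip_def)
  show "strip n c r \<in> sets lebesgue" using strip_borel by (metis sets_completionI_sets sets_lborel)
qed

lemma UN_strip_lmeasurable: "finite B \<Longrightarrow> (\<Union>n\<in>B. strip n c (r n)) \<in> lmeasurable"
  by (intro fmeasurable.finite_UN strip_lmeasurable)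

text \<open>Only \<open>K + 2\<close> integers can come within \<open>r \<le> 1/2\<close> of
  \<open>real K * x + c\<close>; each cuts out an interval of length \<open>2 * r / K\<close>, and
  \<open>K + 2 \<le> 3 * K\<close>. For larger \<open>r\<close> the bound exceeds the length of the
  unit interval.\<close>

lemma measure_strip_le:
  assumes "K \<ge> 1" "r \<ge> 0"
  shows "measure lebesgue (strip K c r) \<le> 6 * r"
proof (cases "r \<le> 1/2")
  case False
  have "measure lebesgue (strip K c r) \<le> measure lebesgue {0..1::real}"
    by (rule measure_mono_fmeasurable)
       (use strip_lmeasurable in \<open>auto simp: strip_def fmeasurable_def\<close>)
  with False show ?thesis by simp
next
  case True
  let ?I = "{\<lfloor>c\<rfloor>..\<lfloor>c\<rfloor> + int K + 1}"
  let ?J = "\<lambda>a::int. {(of_int a - c - r) / real K..(of_int a - c + r) / real K}"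
  have K: "real K > 0" using assms by simp
  have sub: "strip K c r \<subseteq> (\<Union>a\<in>?I. ?J a)"
  proof
    fix x assume x: "x \<in> strip K c r"
    then obtain a :: int where a: "\<bar>real K * x + c - of_int a\<bar> < r"
      by (auto simp: strip_def nearest_int_dist_less_iff)
    have "0 \<le> real K * x" "real K * x < real K" using x K by (auto simp: strip_def)
    then have "real_of_int a > c - 1" "real_of_int a < real K + c + 1"
      using a True by linarith+
    then have "a \<in> ?I" by simp linarith
    moreover have "x \<in> ?J a" using a K by (auto simp: field_simps abs_less_iff)
    ultimately show "x \<in> (\<Union>a\<in>?I. ?J a)" by blast
  qed
  have "measure lebesgue (strip K c r) \<le> measure lebesgue (\<Union>a\<in>?I. ?J a)"
    by (intro measure_mono_fmeasurable sub fmeasurable.finite_UN fmeasurableD[OF strip_lmeasurable])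
       auto
  also have "\<dots> \<le> (\<Sum>a\<in>?I. measure lebesgue (?J a))"
    by (rule measure_UNION_le) auto
  also have "\<dots> = (\<Sum>a\<in>?I. 2 * r / real K)"
    using K assms by (intro sum.cong) (auto simp: field_simps)
  also have "\<dots> = (real K + 2) * (2 * r / real K)" by simp
  also have "\<dots> \<le> (3 * real K) * (2 * r / real K)"
    using assms by (intro mult_right_mono) auto
  also have "\<dots> = 6 * r" using K by simp
  finally show ?thesis .
qed

section \<open>One block of frequencies from the covering conjecture\<close>

lemma interval_thicken_shifted_lattice:
  assumes "k > 0"
  shows "interval_thicken (shifted_lattice (- z) k) (- r) r
           = {x. nearest_int_dist (real k * x + z) < real k * r}"
proof (intro set_eqI iffI)
  fix x assume "x \<in> interval_thicken (shifted_lattice (- z) k) (- r) r"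
  then obtain a :: int and t where x: "x = (of_int a - z) / real k + t" and t: "\<bar>t\<bar> < r"
    by (auto simp: interval_thicken_def shifted_lattice_def abs_less_iff)
  have "real k * x + z - of_int a = real k * t" using assms by (simp add: x field_simps)
  then have "\<bar>real k * x + z - of_int a\<bar> < real k * r" using assms t by (simp add: abs_mult)
  then show "x \<in> {x. nearest_int_dist (real k * x + z) < real k * r}"
    by (auto simp: nearest_int_dist_less_iff)
next
  fix x assume "x \<in> {x. nearest_int_dist (real k * x + z) < real k * r}"
  then obtain a :: int where a: "\<bar>real k * x + z - of_int a\<bar> < real k * r"
    by (auto simp: nearest_int_dist_less_iff)
  define t where "t = x - (of_int a - z) / real k"
  have "real k * x + z - of_int a = real k * t" using assms by (simp add: t_def field_simps)
  with a assms have "\<bar>t\<bar> < r" by (simp add: abs_mult)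
  moreover have "x = (of_int a + - z) / real k + t" by (simp add: t_def)
  ultimately show "x \<in> interval_thicken (shifted_lattice (- z) k) (- r) r"
    unfolding interval_thicken_def shifted_lattice_def by (force simp: abs_less_iff)
qed

text \<open>Supplies one stage of the construction; the parameter \<open>N\<close> lets successive
  stages use disjoint frequencies. The bound \<open>e < 1/4\<close> rules out \<open>M = 1\<close>,
  where the only frequency would be 1.\<close>

lemma covering_block:
  fixes y :: "nat \<Rightarrow> real"
  assumes conj: covering_conjecture and l: "l \<ge> 1"
    and z: "z \<notin> rat_span (insert 1 (y ` {1..l}))" and e: "0 < e" "e < 1/4"
  obtains B and \<phi> :: "nat \<Rightarrow> real" where "finite B" "B \<subseteq> {N<..}" "\<forall>n. \<phi> n \<ge> 0"
    "\<forall>i\<in>{1..l}. measure lebesgue (\<Union>n\<in>B. strip n (y i) (\<phi> n)) \<le> 6 * e"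
    "measure lebesgue (\<Union>n\<in>B. strip n z (\<phi> n)) \<ge> 1 - e"
proof -
  \<comment> \<open>The points \<open>(a + z) / k\<close> describe approximation with shift
    \<open>- z\<close>, so the conjecture is applied to \<open>- z\<close> to obtain the shift
    \<open>z\<close>.\<close>
  have "- z \<notin> rat_span (insert 1 (y ` {1..l}))"
    using z rat_real.span_neg by fastforce
  \<comment> \<open>Both parameters of the conjecture are set to \<open>e\<close>; starting at
    \<open>n 0 = Suc N\<close> forces every later \<open>n m\<close> beyond
    \<open>N\<close>.\<close>
  from conj[unfolded covering_conjecture_def, rule_format, OF l this e(1) e(1) zero_less_Suc[of N]]
  obtain M :: nat and n :: "nat \<Rightarrow> nat" and w :: "nat \<Rightarrow> real" where
    M: "M \<ge> 1" and n0: "n 0 = Suc N" and mono: "strict_mono_on {0..M} n" and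
    w: "\<forall>m\<in>{1..M}. (MAX i\<in>{1..l}. nearest_int_dist (real (n m) * y i - w i)) \<le> e / 2" and
    meas: "let K = (\<Prod>m=1..M. (n m + 1)); k = (\<lambda>m. K div (n m + 1))
           in measure lebesgue
                ((\<Union>m\<in>{1..M}. interval_thicken (shifted_lattice (- z) (k m))
                     (- (e / (2 * real K))) (e / (2 * real K))) \<inter> {0..<1}) \<ge> 1 - e"
    by blast
  define K where "K = (\<Prod>m=1..M. (n m + 1))"
  define k where "k m = K div (n m + 1)" for m
  \<comment> \<open>Multiplication by \<open>j\<close> turns the radius
    \<open>e / (2 * real K)\<close> around a point of denominator \<open>j\<close> into
    \<open>\<phi> j\<close>.\<close>
  define \<phi> where "\<phi> j = real j * (e / (2 * real K))" for j
  have Kpos: "K > 0" unfolding K_def by (simp add: prod_pos)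
  have kprod: "k m = (\<Prod>j\<in>{1..M}-{m}. (n j + 1))" and kK: "K = (n m + 1) * k m"
    if "m \<in> {1..M}" for m
  proof -
    have *: "K = (n m + 1) * (\<Prod>j\<in>{1..M}-{m}. (n j + 1))"
      unfolding K_def using that by (intro prod.remove) auto
    then show "k m = (\<Prod>j\<in>{1..M}-{m}. (n j + 1))" unfolding k_def
      by (metis Suc_eq_plus1 nonzero_mult_div_cancel_left nat.distinct(1))
    with * show "K = (n m + 1) * k m" by simp
  qed
  have kpos: "k m > 0" if "m \<in> {1..M}" for m using kK[OF that] Kpos by (cases "k m") auto
  have cover: "measure lebesgue (\<Union>j\<in>k ` {1..M}. strip j z (\<phi> j)) \<ge> 1 - e"
  proof -
    have "(\<Union>m\<in>{1..M}. interval_thicken (shifted_lattice (- z) (k m))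
                     (- (e / (2 * real K))) (e / (2 * real K))) \<inter> {0..<1}
        = (\<Union>j\<in>k ` {1..M}. strip j z (\<phi> j))"
      using kpos by (auto simp: interval_thicken_shifted_lattice strip_def \<phi>_def)
    with meas show ?thesis unfolding Let_def K_def[symmetric] k_def[symmetric] by simp
  qed
  have nN: "n m > N" if "m \<in> {1..M}" for m
    using strict_mono_onD[OF mono, of 0 m] that n0 by auto
  \<comment> \<open>For \<open>M = 1\<close> the product giving \<open>k 1\<close> is empty, and a
    single strip of frequency 1 has measure at most \<open>3 * e\<close>, which is less than
    \<open>1 - e\<close>.\<close>
  have M2: "M \<ge> 2"
  proof (rule ccontr)
    assume "\<not> M \<ge> 2"
    with M have M1: "M = 1" by simp
    then have "k 1 = 1" using kprod[of 1] by simp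
    with cover M1 have "1 - e \<le> measure lebesgue (strip 1 z (\<phi> 1))" by simp
    also have "\<dots> \<le> 6 * \<phi> 1" using e by (intro measure_strip_le) (auto simp: \<phi>_def)
    also have "\<dots> \<le> 3 * e" using e Kpos by (simp add: \<phi>_def field_simps)
    finally show False using e by simp
  qed
  have kN: "k m > N" if m: "m \<in> {1..M}" for m
  proof -
    \<comment> \<open>A second index \<open>j\<close> contributes the factor \<open>n j + 1\<close>
      to \<open>k m\<close>, which makes the frequency \<open>k m\<close> large.\<close>
    have "(if m = 1 then 2 else 1) \<in> {1..M} - {m}" using M2 by simp
    then obtain j where j: "j \<in> {1..M} - {m}" by blast
    then have "n j + 1 dvd k m" unfolding kprod[OF m] by (intro dvd_prodI) auto
    then have "n j + 1 \<le> k m" using kpos[OF m] by (rule dvd_imp_le)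
    with nN[of j] j show ?thesis by auto
  qed
  have small: "measure lebesgue (\<Union>j\<in>k ` {1..M}. strip j (y i) (\<phi> j)) \<le> 6 * e"
    if i: "i \<in> {1..l}" for i
  proof -
    have "strip (k m) (y i) (\<phi> (k m)) \<subseteq> strip K (y i + w i) e" if m: "m \<in> {1..M}" for m
    proof
      fix x assume x: "x \<in> strip (k m) (y i) (\<phi> (k m))"
      then obtain a :: int where a: "\<bar>real (k m) * x + y i - of_int a\<bar> < \<phi> (k m)"
        by (auto simp: strip_def nearest_int_dist_less_iff)
      let ?n = "real (n m + 1)"
      have KK: "real K = ?n * real (k m)" using kK[OF m] by (metis of_nat_mult)
      have "?n * \<phi> (k m) = (?n * real (k m)) * (e / (2 * real K))"
        by (simp only: \<phi>_def mult.assoc)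
      also have "\<dots> = real K * (e / (2 * real K))" by (simp only: KK[symmetric])
      also have "\<dots> = e / 2" using Kpos by simp
      finally have "?n * \<phi> (k m) = e / 2" .
      then have "?n * \<bar>real (k m) * x + y i - of_int a\<bar> < e / 2"
        using a by (metis mult_strict_left_mono of_nat_0_less_iff zero_less_Suc Suc_eq_plus1)
      then have 1: "\<bar>?n * (real (k m) * x + y i - of_int a)\<bar> < e / 2" by (simp add: abs_mult)
      let ?b = "round (real (n m) * y i - w i)"
      have "nearest_int_dist (real (n m) * y i - w i)
          \<le> (MAX i\<in>{1..l}. nearest_int_dist (real (n m) * y i - w i))"
        using i by (intro Max_ge) auto
      with w m have "nearest_int_dist (real (n m) * y i - w i) \<le> e / 2" by fastforce
      then have 2: "\<bar>real (n m) * y i - w i - of_int ?b\<bar> \<le> e / 2"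
        by (simp add: nearest_int_dist_def)
      \<comment> \<open>As \<open>(n m + 1) * y i\<close> and \<open>n m * y i\<close> differ by
        \<open>y i\<close>, the dependence on \<open>m\<close> is absorbed into the integer and an
        error; the two errors of size \<open>e / 2\<close> add up to less than
        \<open>e\<close>.\<close>
      have "real K * x + (y i + w i) - of_int (int (n m + 1) * a - ?b)
          = ?n * (real (k m) * x + y i - of_int a) - (real (n m) * y i - w i - of_int ?b)"
        by (simp add: KK algebra_simps)
      then have "\<bar>real K * x + (y i + w i) - of_int (int (n m + 1) * a - ?b)\<bar> < e"
        using 1 2 by linarith
      with x show "x \<in> strip K (y i + w i) e"
        unfolding strip_def nearest_int_dist_less_iff by blast
    qed
    then have "(\<Union>j\<in>k ` {1..M}. strip j (y i) (\<phi> j)) \<subseteq> strip K (y i + w i) e" by blast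
    then have "measure lebesgue (\<Union>j\<in>k ` {1..M}. strip j (y i) (\<phi> j))
        \<le> measure lebesgue (strip K (y i + w i) e)"
      by (intro measure_mono_fmeasurable strip_lmeasurable fmeasurableD UN_strip_lmeasurable) auto
    also have "\<dots> \<le> 6 * e" using Kpos e by (intro measure_strip_le) auto
    finally show ?thesis .
  qed
  show thesis
    by (rule that[of "k ` {1..M}" \<phi>]) (use kN small cover e in \<open>auto simp: \<phi>_def\<close>)
qed

section \<open>Passage from the unit interval to the line, and Borel-Cantelli\<close>

lemma AE_lebesgue_periodic:
  fixes P :: "real \<Rightarrow> bool"
  assumes "AE x in lebesgue. x \<in> {0..<1} \<longrightarrow> P x"
    and per: "\<And>x (a::int). P (x + of_int a) \<longleftrightarrow> P x"
  shows "AE x in lebesgue. P x"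
proof -
  obtain N where N: "N \<in> null_sets lebesgue" "{x. \<not> (x \<in> {0..<1} \<longrightarrow> P x)} \<subseteq> N"
    using assms(1) unfolding eventually_ae_filter by auto
  have null: "negligible {x \<in> {0..<1}. \<not> P x}"
    by (rule negligible_subset[of N]) (use N in \<open>auto simp: negligible_iff_null_sets\<close>)
  \<comment> \<open>Countably many integer translates of the exceptional set in \<open>[0,1)\<close>
    cover the whole exceptional set.\<close>
  have "negligible (\<Union>a::int. (+) (of_int a) ` {x \<in> {0..<1}. \<not> P x})"
    by (intro negligible_countable_Union) (use null negligible_translation in auto)
  moreover have "{x. \<not> P x} \<subseteq> (\<Union>a::int. (+) (of_int a) ` {x \<in> {0..<1}. \<not> P x})"
  proof
    fix x assume "x \<in> {x. \<not> P x}"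
    then have "\<not> P (frac x)" using per[of "frac x" "\<lfloor>x\<rfloor>"] by (simp add: frac_def)
    then have "frac x \<in> {x \<in> {0..<1}. \<not> P x}" by (simp add: frac_lt_1)
    moreover have "x = of_int \<lfloor>x\<rfloor> + frac x" by (simp add: frac_def)
    ultimately show "x \<in> (\<Union>a::int. (+) (of_int a) ` {x \<in> {0..<1}. \<not> P x})" by blast
  qed
  ultimately have "negligible {x. \<not> P x}" by (rule negligible_subset)
  then have "{x. \<not> P x} \<in> null_sets lebesgue" by (simp add: negligible_iff_null_sets)
  then show ?thesis by (rule AE_I') auto
qed

text \<open>First Borel-Cantelli lemma with a majorant required only eventually, since each
  \<open>y i\<close> is controlled only from some stage on.\<close>

lemma AE_eventually_notin:
  fixes A :: "nat \<Rightarrow> real set"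
  assumes "\<And>s. A s \<in> lmeasurable" "summable g"
    "eventually (\<lambda>s. measure lebesgue (A s) \<le> g s) sequentially"
  shows "AE x in lebesgue. eventually (\<lambda>s. x \<notin> A s) sequentially"
proof -
  have "AE x in lebesgue. eventually (\<lambda>s. x \<in> space lebesgue - A s) sequentially"
  proof (rule borel_cantelli_AE1)
    show "A s \<in> sets lebesgue" "emeasure lebesgue (A s) < \<infinity>" for s
      using assms(1)[of s] by (auto simp: fmeasurable_def)
    show "summable (\<lambda>s. measure lebesgue (A s))"
      by (rule summable_comparison_test_ev[OF _ assms(2)]) (use assms(3) in simp)
  qed
  then show ?thesis by simp
qed

lemma nearest_int_dist_periodic:
  "nearest_int_dist (real n * (x + of_int a) + c) = nearest_int_dist (real n * x + c)"
proof -
  have "real n * (x + of_int a) + c = (real n * x + c) + of_int (int n * a)"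
    by (simp add: algebra_simps)
  then show ?thesis by (simp only: nearest_int_dist_add_int)
qed

section \<open>Concatenation of the blocks\<close>

theorem theorem1p2:
  fixes y z :: "nat \<Rightarrow> real"
  assumes conj: covering_conjecture
    and indep: "\<And>i F. i \<ge> 1 \<Longrightarrow> finite F \<Longrightarrow> F \<subseteq> y ` {1..} \<Longrightarrow> z i \<notin> rat_span (insert 1 F)"
  shows "\<exists>\<psi> :: nat \<Rightarrow> real.
           (\<forall>n\<ge>1. \<psi> n \<ge> 0) \<and>
           \<not> summable (\<lambda>n. \<psi> (Suc n)) \<and>
           (\<forall>i\<ge>1. AE x in lebesgue.
              \<not> infinite {n::nat. n \<ge> 1 \<and> nearest_int_dist (real n * x + y i) < \<psi> n}) \<and>
           (\<forall>i\<ge>1. AE x in lebesgue.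
              infinite {n::nat. n \<ge> 1 \<and> nearest_int_dist (real n * x + z i) < \<psi> n})"
proof -
  define e :: "nat \<Rightarrow> real" where "e s = (1/8) * (1/2) ^ s" for s
  have e: "0 < e s" "e s < 1/4" for s
    using power_le_one[of "1/2::real" s] by (auto simp: e_def)
  have summable_e: "summable e" unfolding e_def by (intro summable_mult summable_geometric) simp
  \<comment> \<open>The first component of \<open>prod_decode\<close> takes each value infinitely
    often, so every \<open>z i\<close> is targeted at infinitely many stages; \<open>Suc\<close>
    makes the indices start at 1.\<close>
  define \<iota> where "\<iota> s = Suc (fst (prod_decode s))" for s
  \<comment> \<open>Stage \<open>s\<close> controls only \<open>y 1\<close> to
    \<open>y (Suc s)\<close>, so each \<open>y i\<close> escapes control at finitely many stages
    only. \<open>N'\<close> is where the next block may start.\<close>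
  define good where "good s N B \<phi> N' \<longleftrightarrow> B \<subseteq> {N<..N'} \<and> N \<le> N' \<and> (\<forall>n. \<phi> n \<ge> (0::real)) \<and>
      (\<forall>i\<in>{1..Suc s}. measure lebesgue (\<Union>n\<in>B. strip n (y i) (\<phi> n)) \<le> 6 * e s) \<and>
      measure lebesgue (\<Union>n\<in>B. strip n (z (\<iota> s)) (\<phi> n)) \<ge> 1 - e s"
    for s N B \<phi> N'
  have "\<exists>B \<phi> N'. good s N B \<phi> N'" for s N
  proof -
    have l: "Suc s \<ge> 1" by simp
    have "z (\<iota> s) \<notin> rat_span (insert 1 (y ` {1..Suc s}))"
      by (intro indep) (auto simp: \<iota>_def)
    note block = covering_block[OF conj l this e(1)[of s] e(2)[of s], of N]
    obtain B and \<phi> :: "nat \<Rightarrow> real" where B: "finite B" "B \<subseteq> {N<..}" and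
      \<phi>: "\<forall>n. \<phi> n \<ge> 0"
      "\<forall>i\<in>{1..Suc s}. measure lebesgue (\<Union>n\<in>B. strip n (y i) (\<phi> n)) \<le> 6 * e s"
      "measure lebesgue (\<Union>n\<in>B. strip n (z (\<iota> s)) (\<phi> n)) \<ge> 1 - e s"
      by (rule block)
    \<comment> \<open>Inserting \<open>N\<close> keeps the maximum meaningful and at least
      \<open>N\<close> even if \<open>B\<close> is empty.\<close>
    have "B \<subseteq> {N<..Max (insert N B)}" using B by auto
    moreover have "N \<le> Max (insert N B)" using B by simp
    ultimately show ?thesis unfolding good_def using \<phi> by blast
  qed
  then obtain Bf \<phi>f Nf where "\<And>s N. good s N (Bf s N) (\<phi>f s N) (Nf s N)" by metis
  then have f: "\<And>s N. Bf s N \<subseteq> {N<..Nf s N}" "\<And>s N. N \<le> Nf s N"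
    "\<And>s N n. (\<phi>f s N n :: real) \<ge> 0"
    "\<And>s N i. i \<in> {1..Suc s} \<Longrightarrow>
        measure lebesgue (\<Union>n\<in>Bf s N. strip n (y i) (\<phi>f s N n)) \<le> 6 * e s"
    "\<And>s N. measure lebesgue (\<Union>n\<in>Bf s N. strip n (z (\<iota> s)) (\<phi>f s N n)) \<ge> 1 - e s"
    unfolding good_def by blast+
  define T where "T = rec_nat 0 Nf"
  have T_Suc: "T (Suc s) = Nf s (T s)" for s by (simp add: T_def)
  define B where "B s = Bf s (T s)" for s
  define \<phi> where "\<phi> s = \<phi>f s (T s)" for s
  have B_sub: "B s \<subseteq> {T s<..T (Suc s)}" for s using f(1) by (simp add: B_def T_Suc)
  have finB: "finite (B s)" for s using B_sub by (rule finite_subset) simp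
  have T_mono: "mono T" by (rule incseq_SucI) (simp add: T_Suc f(2))
  have disj: "s = t" if "n \<in> B s" "n \<in> B t" for n s t
  proof -
    have "\<not> s < t" if "n \<in> B s" "n \<in> B t" for s t
    proof
      assume "s < t"
      then have "T (Suc s) \<le> T t" by (intro monoD[OF T_mono]) simp
      with B_sub[of s] B_sub[of t] that show False by force
    qed
    with that show ?thesis by (meson linorder_neqE_nat)
  qed
  \<comment> \<open>Disjointness of the blocks makes the stage unique. Off the blocks the value 0
    yields no solutions, because the inequality is strict.\<close>
  define \<psi> where "\<psi> n = (if \<exists>s. n \<in> B s then \<phi> (THE s. n \<in> B s) n else 0)" for n
  have \<psi>_B: "\<psi> n = \<phi> s n" if "n \<in> B s" for n s
  proof -
    have "(THE s. n \<in> B s) = s" using that disj by blast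
    with that show ?thesis by (auto simp: \<psi>_def)
  qed
  have \<psi>_nonneg: "\<psi> n \<ge> 0" for n by (simp add: \<psi>_def \<phi>_def f(3))
  have \<psi>_pos: "\<exists>s. n \<in> B s" if "nearest_int_dist t < \<psi> n" for n t
    using that nearest_int_dist_nonneg[of t] by (metis \<psi>_def not_less)
  have B_pos: "n \<ge> 1" if "n \<in> B s" for n s using B_sub that by fastforce
  have small: "measure lebesgue (\<Union>n\<in>B s. strip n (y i) (\<psi> n)) \<le> 6 * e s" if "i \<in> {1..Suc s}" for i s
  proof -
    have "(\<Union>n\<in>B s. strip n (y i) (\<psi> n)) = (\<Union>n\<in>B s. strip n (y i) (\<phi> s n))"
      by (intro SUP_cong) (auto simp: \<psi>_B)
    then show ?thesis using f(4)[OF that] by (simp add: B_def \<phi>_def)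
  qed
  have big: "measure lebesgue (\<Union>n\<in>B s. strip n (z (\<iota> s)) (\<psi> n)) \<ge> 1 - e s" for s
  proof -
    have "(\<Union>n\<in>B s. strip n (z (\<iota> s)) (\<psi> n)) = (\<Union>n\<in>B s. strip n (z (\<iota> s)) (\<phi> s n))"
      by (intro SUP_cong) (auto simp: \<psi>_B)
    then show ?thesis using f(5) by (simp add: B_def \<phi>_def)
  qed
  let ?S = "\<lambda>c x. {n::nat. n \<ge> 1 \<and> nearest_int_dist (real n * x + c) < \<psi> n}"
  have y_part: "AE x in lebesgue. \<not> infinite (?S (y i) x)" if i: "i \<ge> 1" for i
  proof (rule AE_lebesgue_periodic)
    have "AE x in lebesgue. eventually (\<lambda>s. x \<notin> (\<Union>n\<in>B s. strip n (y i) (\<psi> n))) sequentially"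
    proof (rule AE_eventually_notin)
      show "(\<Union>n\<in>B s. strip n (y i) (\<psi> n)) \<in> lmeasurable" for s
        by (rule UN_strip_lmeasurable) (rule finB)
      show "summable (\<lambda>s. 6 * e s)" using summable_e by (rule summable_mult)
      show "\<forall>\<^sub>F s in sequentially. measure lebesgue (\<Union>n\<in>B s. strip n (y i) (\<psi> n)) \<le> 6 * e s"
        using eventually_ge_at_top[of i] by eventually_elim (use i in \<open>auto intro!: small\<close>)
    qed
    then show "AE x in lebesgue. x \<in> {0..<1} \<longrightarrow> \<not> infinite (?S (y i) x)"
    proof (rule AE_mp, intro AE_I2 impI)
      fix x :: real
      assume "eventually (\<lambda>s. x \<notin> (\<Union>n\<in>B s. strip n (y i) (\<psi> n))) sequentially" and x: "x \<in> {0..<1}"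
      then obtain s0 where s0: "\<And>s. s \<ge> s0 \<Longrightarrow> x \<notin> (\<Union>n\<in>B s. strip n (y i) (\<psi> n))"
        by (auto simp: eventually_sequentially)
      \<comment> \<open>Every solution lies in some block, and only the finitely many blocks before
        stage \<open>s0\<close> can contain one.\<close>
      have "?S (y i) x \<subseteq> (\<Union>s<s0. B s)"
      proof
        fix n assume n: "n \<in> ?S (y i) x"
        then obtain s where s: "n \<in> B s" using \<psi>_pos by blast
        with n x have "x \<in> (\<Union>n\<in>B s. strip n (y i) (\<psi> n))" by (auto simp: strip_def)
        with s0 have "s < s0" using not_less by blast
        with s show "n \<in> (\<Union>s<s0. B s)" by blast
      qed
      then show "\<not> infinite (?S (y i) x)" using finB by (auto dest: finite_subset)
    qed
  qed (simp add: nearest_int_dist_periodic)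
  have z_part: "AE x in lebesgue. infinite (?S (z i) x)" if i: "i \<ge> 1" for i
  proof (rule AE_lebesgue_periodic)
    \<comment> \<open>Taking the empty set at stages aimed at another shift keeps the bound
      \<open>e s\<close> valid for all \<open>s\<close>.\<close>
    define A where "A s = (if \<iota> s = i then {0..<1} - (\<Union>n\<in>B s. strip n (z i) (\<psi> n)) else {})" for s
    have "AE x in lebesgue. eventually (\<lambda>s. x \<notin> A s) sequentially"
    proof (rule AE_eventually_notin[OF _ summable_e])
      have unit: "{0..<1::real} \<in> lmeasurable"
        using fmeasurable_cbox by (intro bounded_set_imp_lmeasurable) auto
      show "A s \<in> lmeasurable" for s
        using fmeasurable.Diff[OF unit UN_strip_lmeasurable[OF finB]] by (simp add: A_def)
      have "measure lebesgue (A s) \<le> e s" for s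
      proof (cases "\<iota> s = i")
        case True
        then have "A s = {0..<1} - (\<Union>n\<in>B s. strip n (z i) (\<psi> n))" by (simp add: A_def)
        also have "measure lebesgue \<dots>
          = measure lebesgue {0..<1::real} - measure lebesgue (\<Union>n\<in>B s. strip n (z i) (\<psi> n))"
          by (intro measurable_measure_Diff unit fmeasurableD UN_strip_lmeasurable finB)
             (auto simp: strip_def)
        finally show ?thesis using big[of s] True by simp
      qed (use e(1)[of s] in \<open>simp add: A_def\<close>)
      then show "\<forall>\<^sub>F s in sequentially. measure lebesgue (A s) \<le> e s" by simp
    qed
    then show "AE x in lebesgue. x \<in> {0..<1} \<longrightarrow> infinite (?S (z i) x)"
    proof (rule AE_mp, intro AE_I2 impI)
      fix x :: real
      assume "eventually (\<lambda>s. x \<notin> A s) sequentially" and x: "x \<in> {0..<1}"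
      then obtain s0 where s0: "\<And>s. s \<ge> s0 \<Longrightarrow> x \<notin> A s"
        by (auto simp: eventually_sequentially)
      \<comment> \<open>Enumerates stages aimed at \<open>z i\<close>; since
        \<open>prod_encode\<close> dominates its second argument, the summand \<open>s0\<close> puts
        them all past \<open>s0\<close>.\<close>
      define \<sigma> where "\<sigma> j = prod_encode (i - 1, j + s0)" for j
      have \<sigma>: "\<iota> (\<sigma> j) = i" "\<sigma> j \<ge> s0" for j
        using i le_prod_encode_2[of "j + s0" "i - 1"] by (auto simp: \<sigma>_def \<iota>_def)
      have "\<exists>n. n \<in> B (\<sigma> j) \<and> n \<in> ?S (z i) x" for j
        using s0[OF \<sigma>(2), of j] x \<sigma>(1)[of j] B_pos by (auto simp: A_def strip_def)
      then obtain g where g: "\<And>j. g j \<in> B (\<sigma> j)" "\<And>j. g j \<in> ?S (z i) x" by metis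
      \<comment> \<open>Distinct stages have disjoint blocks, so the chosen solutions are pairwise
        different.\<close>
      have "inj \<sigma>" by (rule injI) (simp add: \<sigma>_def)
      then have "inj g" using g(1) disj by (metis injD injI)
      then show "infinite (?S (z i) x)"
        using g(2) by (meson image_subset_iff infinite_iff_countable_subset)
    qed
  qed (simp add: nearest_int_dist_periodic)
  have "\<not> summable (\<lambda>n. \<psi> (Suc n))"
  proof
    assume sm: "summable (\<lambda>n. \<psi> (Suc n))"
    have "AE x in lebesgue. eventually (\<lambda>n. x \<notin> strip (Suc n) (z 1) (\<psi> (Suc n))) sequentially"
      by (rule AE_eventually_notin[OF strip_lmeasurable summable_mult[OF sm, of 6]])
         (simp add: measure_strip_le \<psi>_nonneg)
    with z_part[OF order_refl] have "AE x in lebesgue. x \<in> {0..<1::real} \<longrightarrow> False"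
    proof eventually_elim
      case (elim x)
      show ?case
      proof
        assume x: "x \<in> {0..<1}"
        from elim(2) obtain m where m: "\<And>n. n \<ge> m \<Longrightarrow> x \<notin> strip (Suc n) (z 1) (\<psi> (Suc n))"
          by (auto simp: eventually_sequentially)
        have "?S (z 1) x \<subseteq> {..m}"
        proof
          fix n assume n: "n \<in> ?S (z 1) x"
          then have "\<not> n - 1 \<ge> m" using m[of "n - 1"] x by (auto simp: strip_def)
          then show "n \<in> {..m}" by simp
        qed
        with elim(1) show False using finite_subset by blast
      qed
    qed
    \<comment> \<open>The constant predicate \<open>False\<close> is periodic, so the contradiction
      on \<open>[0,1)\<close> would make the whole line null.\<close>
    then have "AE x::real in lebesgue. False" by (rule AE_lebesgue_periodic) simp
    then show False by (simp add: AE_iff_null null_sets_def)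
  qed
  with \<psi>_nonneg y_part z_part show ?thesis by blast
qed

end
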